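(* For every connected 3-uniform hypergraph $H$, we have $f(H,\mathcal{T})=R_2(H)$.
   Context: For a 3-graph $H$, $R_2(H)$ is the minimum $n$ such that every 2-edge-coloring of the complete 3-uniform hypergraph $K^{(3)}_n$ contains a monochromatic copy of $H$. For 3-graphs $H,G$, the constrained Ramsey number $f(H,G)$ is the minimum $n$ such that every edge-coloring of $K^{(3)}_n$ with any number of colors contains either a monochromatic copy of $H$ (all edges same color) or a rainbow copy of $G$ (all edges distinct colors). The tight path $\mathcal{T}$ is the 3-graph with vertices $v_1,\ldots,v_5$ and edges $\{v_1v_2v_3,v_2v_3v_4,v_3v_4v_5\}$.
   Formalization: The 3-graph H with 4 vertices and 2 edges is excluded, since the claim fails for it: R_2(H)=4 by pigeonhole, but K_4^(3) coloured with four distinct colours has no monochromatic H and is too small for the tight path, so f(H,T)=5. *)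

theory Defs
  imports "HOL-Library.Ramsey"
begin

type_synonym 'a hypergraph = "'a set \<times> 'a set set"

abbreviation verts :: "'a hypergraph \<Rightarrow> 'a set" where
  "verts H \<equiv> fst H"

abbreviation hedges :: "'a hypergraph \<Rightarrow> 'a set set" where
  "hedges H \<equiv> snd H"

definition three_graph :: "'a hypergraph \<Rightarrow> bool" where
  "three_graph H \<longleftrightarrow> finite (verts H) \<and> hedges H \<subseteq> [verts H]\<^bsup>3\<^esup>"

definition complete_three_graph :: "nat \<Rightarrow> nat hypergraph" where
  "complete_three_graph n = ({..<n}, [{..<n}]\<^bsup>3\<^esup>)"

definition connected_hypergraph :: "'a hypergraph \<Rightarrow> bool" where
  "connected_hypergraph H \<longleftrightarrow>
     (\<forall>u \<in> verts H. \<forall>v \<in> verts H. (u, v) \<in> {(x, y). \<exists>e \<in> hedges H. x \<in> e \<and> y \<in> e}\<^sup>*)"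

text \<open>A copy of \<open>H\<close> in \<open>K\<close> is the image of \<open>H\<close> under such a map; it need not be induced.\<close>

definition hembedding :: "('a \<Rightarrow> 'b) \<Rightarrow> 'a hypergraph \<Rightarrow> 'b hypergraph \<Rightarrow> bool" where
  "hembedding \<phi> H K \<longleftrightarrow>
     inj_on \<phi> (verts H) \<and> \<phi> ` verts H \<subseteq> verts K \<and> (\<forall>e \<in> hedges H. \<phi> ` e \<in> hedges K)"

definition has_mono_copy :: "('b set \<Rightarrow> 'c) \<Rightarrow> 'a hypergraph \<Rightarrow> 'b hypergraph \<Rightarrow> bool" where
  "has_mono_copy c H K \<longleftrightarrow> (\<exists>\<phi>. hembedding \<phi> H K \<and> (\<exists>k. \<forall>e \<in> hedges H. c (\<phi> ` e) = k))"

definition has_rainbow_copy :: "('b set \<Rightarrow> 'c) \<Rightarrow> 'a hypergraph \<Rightarrow> 'b hypergraph \<Rightarrow> bool" where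
  "has_rainbow_copy c G K \<longleftrightarrow> (\<exists>\<phi>. hembedding \<phi> G K \<and> inj_on (\<lambda>e. c (\<phi> ` e)) (hedges G))"

definition ramsey_two :: "'a hypergraph \<Rightarrow> nat" where
  "ramsey_two H = (LEAST n. \<forall>c :: nat set \<Rightarrow> nat.
     c \<in> hedges (complete_three_graph n) \<rightarrow> {..<2} \<longrightarrow> has_mono_copy c H (complete_three_graph n))"

text \<open>Since the complete 3-graph on \<open>n\<close> vertices has finitely many edges, natural numbers
  suffice as colours for colourings with any number of colours.\<close>

definition constrained_ramsey :: "'a hypergraph \<Rightarrow> 'b hypergraph \<Rightarrow> nat" where
  "constrained_ramsey H G = (LEAST n. \<forall>c :: nat set \<Rightarrow> nat.
     has_mono_copy c H (complete_three_graph n) \<or> has_rainbow_copy c G (complete_three_graph n))"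

definition tight_path :: "nat hypergraph" where
  "tight_path = ({1, 2, 3, 4, 5}, {{1, 2, 3}, {2, 3, 4}, {3, 4, 5}})"

text \<open>Two edges sharing two vertices; up to isomorphism, the only 3-graph with 4 vertices and
  2 edges. It is connected, but \<open>constrained_ramsey\<close> with \<open>tight_path\<close> gives 5 whereas
  \<open>ramsey_two\<close> gives at most 4: the complete 3-graph on 4 vertices with four distinct colours
  has no two edges of the same colour, and is too small to contain a tight path.\<close>

definition two_edge_path :: "nat hypergraph" where
  "two_edge_path = ({1, 2, 3, 4}, {{1, 2, 3}, {2, 3, 4}})"

lemma three_graph_two_edge_path: "three_graph two_edge_path"
  by (auto simp: three_graph_def two_edge_path_def nsets_def)

lemma connected_two_edge_path: "connected_hypergraph two_edge_path"
proof -
  let ?R = "{(x, y). \<exists>e \<in> hedges two_edge_path. x \<in> e \<and> y \<in> e}"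
  have "(u, 2) \<in> ?R" "(2, u) \<in> ?R" if "u \<in> verts two_edge_path" for u
    using that by (auto simp: two_edge_path_def)
  then show ?thesis
    unfolding connected_hypergraph_def by (meson r_into_rtrancl rtrancl_trans)
qed

lemma two_edge_path_mono:
  fixes c :: "nat set \<Rightarrow> nat"
  assumes "distinct [p, q, r, s]" "{p, q, r, s} \<subseteq> {..<n}" "c {p, q, r} = c {q, r, s}"
  shows "has_mono_copy c two_edge_path (complete_three_graph n)"
proof -
  define \<phi> where "\<phi> = (\<lambda>i::nat. if i = 1 then p else if i = 2 then q else if i = 3 then r else s)"
  have "hembedding \<phi> two_edge_path (complete_three_graph n)"
    using assms(1,2)
    by (auto simp: hembedding_def two_edge_path_def complete_three_graph_def \<phi>_def inj_on_def
        nsets_def)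
  moreover have "\<forall>e \<in> hedges two_edge_path. c (\<phi> ` e) = c {p, q, r}"
    using assms(3) by (auto simp: two_edge_path_def \<phi>_def insert_commute)
  ultimately show ?thesis
    unfolding has_mono_copy_def by blast
qed

lemma tight_path_rainbow:
  fixes c :: "nat set \<Rightarrow> nat"
  assumes "distinct [p, q, r, s, t]" "{p, q, r, s, t} \<subseteq> {..<n}"
    and "distinct [c {p, q, r}, c {q, r, s}, c {r, s, t}]"
  shows "has_rainbow_copy c tight_path (complete_three_graph n)"
proof -
  define \<phi> where "\<phi> = (\<lambda>i::nat. if i = 1 then p else if i = 2 then q else if i = 3 then r
    else if i = 4 then s else t)"
  have "hembedding \<phi> tight_path (complete_three_graph n)"
    using assms(1,2)
    by (auto simp: hembedding_def tight_path_def complete_three_graph_def \<phi>_def inj_on_def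
        nsets_def)
  moreover have "inj_on (\<lambda>e. c (\<phi> ` e)) (hedges tight_path)"
    using assms(3) by (auto simp: tight_path_def \<phi>_def inj_on_def insert_commute)
  ultimately show ?thesis
    unfolding has_rainbow_copy_def by blast
qed

lemma hembedding_card:
  assumes "hembedding \<phi> H (complete_three_graph n)"
  shows "card (verts H) \<le> n"
  using assms card_inj_on_le[of \<phi> "verts H" "{..<n}"]
  by (simp add: hembedding_def complete_three_graph_def)

lemma constrained_ramsey_two_edge_path:
  "constrained_ramsey two_edge_path tight_path = 5"
  unfolding constrained_ramsey_def
proof (rule Least_equality)
  show "\<forall>c :: nat set \<Rightarrow> nat. has_mono_copy c two_edge_path (complete_three_graph 5) \<or>
      has_rainbow_copy c tight_path (complete_three_graph 5)"
  proof (intro allI, rule ccontr)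
    fix c :: "nat set \<Rightarrow> nat"
    assume *: "\<not> (has_mono_copy c two_edge_path (complete_three_graph 5) \<or>
      has_rainbow_copy c tight_path (complete_three_graph 5))"
    have mono: "c {p, q, r} \<noteq> c {q, r, s}"
      if "distinct [p, q, r, s]" "{p, q, r, s} \<subseteq> {..<5}" for p q r s
      using * two_edge_path_mono[OF that] by blast
    have tight: "c {p, q, r} = c {r, s, t}"
      if "distinct [p, q, r, s, t]" "{p, q, r, s, t} \<subseteq> {..<5}" for p q r s t
    proof -
      have "c {p, q, r} \<noteq> c {q, r, s}" "c {q, r, s} \<noteq> c {r, s, t}"
        using mono[of p q r s] mono[of q r s t] that by simp_all
      then show ?thesis
        using * tight_path_rainbow[OF that] by auto
    qed
    have "c {0, 1, 2} = c {2, 3, 4}" "c {3, 2, 4} = c {4, 0, 1}"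
      using tight[of 0 1 2 3 4] tight[of 3 2 4 0 1] by simp_all
    moreover have "c {2, 0, 1} \<noteq> c {0, 1, 4}"
      using mono[of 2 0 1 4] by simp
    ultimately show False
      by (simp add: insert_commute)
  qed
next
  fix n
  assume *: "\<forall>c :: nat set \<Rightarrow> nat. has_mono_copy c two_edge_path (complete_three_graph n) \<or>
      has_rainbow_copy c tight_path (complete_three_graph n)"
  show "5 \<le> n"
  proof (rule ccontr)
    assume "\<not> 5 \<le> n"
    obtain c :: "nat set \<Rightarrow> nat" where c: "inj_on c (Pow {..<n})"
      using finite_imp_inj_to_nat_seg[of "Pow {..<n}"] by auto
    have "card (verts tight_path) = 5"
      by (simp add: tight_path_def)
    then have "\<not> has_rainbow_copy c tight_path (complete_three_graph n)"
      using hembedding_card[where H = tight_path and n = n] \<open>\<not> 5 \<le> n\<close>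
      by (auto simp: has_rainbow_copy_def)
    then have "has_mono_copy c two_edge_path (complete_three_graph n)"
      using * by blast
    then obtain \<phi> where \<phi>: "hembedding \<phi> two_edge_path (complete_three_graph n)"
      and "c (\<phi> ` {1, 2, 3}) = c (\<phi> ` {2, 3, 4})"
      by (auto simp: has_mono_copy_def two_edge_path_def)
    moreover have "\<phi> ` {1, 2, 3} \<in> Pow {..<n}" "\<phi> ` {2, 3, 4} \<in> Pow {..<n}"
      using \<phi> by (auto simp: hembedding_def two_edge_path_def complete_three_graph_def)
    ultimately have "\<phi> ` {1, 2, 3} = \<phi> ` {2, 3, 4}"
      using c by (meson inj_onD)
    moreover have "inj_on \<phi> {1, 2, 3, 4}"
      using \<phi> by (simp add: hembedding_def two_edge_path_def)
    ultimately have "{1, 2, 3} = {2, 3, 4 :: nat}"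
      using inj_on_image_eq_iff[of \<phi> "{1, 2, 3, 4}" "{1, 2, 3}" "{2, 3, 4}"] by simp
    then show False
      by (auto simp: set_eq_iff)
  qed
qed

lemma ramsey_two_two_edge_path: "ramsey_two two_edge_path \<le> 4"
  unfolding ramsey_two_def
proof (rule Least_le, intro allI impI)
  fix c :: "nat set \<Rightarrow> nat"
  assume "c \<in> hedges (complete_three_graph 4) \<rightarrow> {..<2}"
  then have "c {0, 1, 2} < 2" "c {1, 2, 3} < 2" "c {0, 1, 3} < 2"
    by (auto simp: complete_three_graph_def nsets_def Pi_iff)
  then consider "c {0, 1, 2} = c {1, 2, 3}" | "c {2, 0, 1} = c {0, 1, 3}" | "c {2, 1, 3} = c {1, 3, 0}"
    by (fastforce simp: insert_commute less_2_cases_iff)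
  then show "has_mono_copy c two_edge_path (complete_three_graph 4)"
    using two_edge_path_mono[of 0 1 2 3 4 c] two_edge_path_mono[of 2 0 1 3 4 c]
      two_edge_path_mono[of 2 1 3 0 4 c]
    by cases simp_all
qed

end

theory Submission
  imports Defs
begin

text \<open>
  Passing to complements of triples, a tight path inside a 5-set becomes a path with three edges
  in the complete graph on these five vertices, so a colouring without a rainbow tight path uses
  at most two colours on every 5-set. Applied to the links of vertices this gives at most two
  colours at every vertex, and since any three vertices form a triple,
  some colour \<open>z\<close> is such that every vertex sees at most one colour besides \<open>z\<close>. Identify all
  colours other than \<open>z\<close>: a connected hypergraph that avoids \<open>z\<close> then has only one colour.
  On at most four vertices no tight path fits, and splitting the four triples into two pairs
  shows that only hypergraphs with at most two edges are relevant.
\<close>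

section \<open>Two-coloured complete graphs\<close>

text \<open>Graph colourings are binary functions, with symmetry assumed separately, so that
  \<open>c (T - {x, y})\<close> and \<open>c {v, x, y}\<close> can serve as colourings
  directly.\<close>

definition uses_two_colours :: "('a \<Rightarrow> 'a \<Rightarrow> 'c) \<Rightarrow> 'a set \<Rightarrow> bool" where
  "uses_two_colours d S \<longleftrightarrow>
     (\<exists>i j. \<forall>x \<in> S. \<forall>y \<in> S. x \<noteq> y \<longrightarrow> d x y = i \<or> d x y = j)"

text \<open>If adjacent edges never differ in colour, a connecting edge shows that any two edges
  agree. Hence one may start from two adjacent edges of different colours, which name the two
  candidates.\<close>

lemma uses_two_coloursI_adjacent:
  assumes sym: "\<And>x y. d x y = d y x"
    and adj: "\<And>x y z. \<lbrakk>x \<in> S; y \<in> S; z \<in> S; distinct [x, y, z]; d x y \<noteq> d y z\<rbrakk> \<Longrightarrow>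
      uses_two_colours d S"
  shows "uses_two_colours d S"
proof (rule ccontr)
  assume no: "\<not> uses_two_colours d S"
  then obtain p q where pq: "p \<in> S" "q \<in> S" "p \<noteq> q"
    unfolding uses_two_colours_def by blast
  have eq: "d x y = d y z" if "x \<in> S" "y \<in> S" "z \<in> S" "distinct [x, y, z]" for x y z
    using adj[OF that] no by blast
  have "d x y = d p q" if "x \<in> S" "y \<in> S" "x \<noteq> y" for x y
  proof (cases "x = p \<or> x = q")
    case True
    then show ?thesis
      using eq[of y p q] eq[of y q p] pq that sym[of x y] sym[of p q]
      by (cases "y = p \<or> y = q") auto
  next
    case False
    then have "d x p = d p q"
      using eq[of x p q] that pq by auto
    moreover have "d x y = d x p"
      using eq[of y x p] that pq False sym[of x y] by (cases "y = p") auto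
    ultimately show ?thesis
      by simp
  qed
  then show False
    using no unfolding uses_two_colours_def by blast
qed

text \<open>The path \<open>x y z\<close> already shows two colours; paths through edges with known
  colours exclude a third colour from the remaining edges one after another.\<close>

lemma five_vertices_without_rainbow_path:
  assumes sym: "\<And>x y. d x y = d y x"
    and S: "card S = 5"
    and path: "\<And>p q r s. \<lbrakk>{p, q, r, s} \<subseteq> S; distinct [p, q, r, s]\<rbrakk> \<Longrightarrow>
      d p q = d q r \<or> d q r = d r s \<or> d p q = d r s"
  shows "uses_two_colours d S"
  using sym
proof (rule uses_two_coloursI_adjacent)
  fix x y z
  assume xyz: "x \<in> S" "y \<in> S" "z \<in> S" "distinct [x, y, z]" and neq: "d x y \<noteq> d y z"
  have "card (S - {x, y, z}) = 2"
    using S xyz by (simp add: card_Diff_subset)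
  then obtain v w where vw: "S - {x, y, z} = {v, w}" "v \<noteq> w"
    by (meson card_2_iff)
  then have dist: "distinct [x, y, z, v, w]"
    using xyz(4) by auto
  have S_eq: "S = {x, y, z, v, w}"
    using vw xyz by blast
  note P = path[unfolded S_eq, simplified]
  let ?ok = "\<lambda>t. t = d x y \<or> t = d y z"
  have zv: "?ok (d z v)" and zw: "?ok (d z w)"
    using P[of x y z v] P[of x y z w] neq dist by auto
  have xv: "?ok (d x v)" and xw: "?ok (d x w)"
    using P[of v x y z] P[of w x y z] neq dist sym[of v x] sym[of w x] by auto
  \<comment> \<open>With a third colour on \<open>v w\<close>, the path \<open>y x v w\<close>
    forces \<open>d x v = d x y\<close> and the path \<open>y z w v\<close> forces
    \<open>d z w = d y z\<close>, so \<open>x v w z\<close> is rainbow.\<close>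
  have vw: "?ok (d v w)"
  proof -
    have "d y z = d z v \<or> d z v = d v w \<or> d y z = d v w"
      "d x y = d x v \<or> d x v = d v w \<or> d x y = d v w"
      "d x v = d v w \<or> d v w = d z w \<or> d x v = d z w"
      "d y z = d z w \<or> d z w = d v w \<or> d y z = d v w"
      using P[of y z v w] P[of y x v w] P[of x v w z] P[of y z w v] dist
        sym[of y x] sym[of w z] sym[of w v] by auto
    then show ?thesis
      using zv zw xv xw neq by argo
  qed
  \<comment> \<open>A third colour on \<open>y s\<close> forces \<open>d x t = d x y\<close> and
    \<open>d x s = d y z\<close>, which makes \<open>y s x t\<close> rainbow.\<close>
  have at_y: "?ok (d y s)" if "{s, t} = {v, w}" for s t
  proof (rule ccontr)
    have st: "distinct [x, y, z, s, t]" "?ok (d x s)" "?ok (d x t)" "?ok (d z s)" "?ok (d z t)"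
      using that dist xv xw zv zw by (auto simp: doubleton_eq_iff)
    have in_S: "{s, t} \<subseteq> {x, y, z, v, w}"
      using that by auto
    assume no: "\<not> ?ok (d y s)"
    have "d x t = d x y"
      using P[of s y x t] no st in_S sym[of s y] sym[of y x] by auto
    moreover have "d x s = d y z"
      using P[of z y s x] no st in_S sym[of z y] sym[of s x] by auto
    ultimately show False
      using P[of y s x t] no st in_S neq sym[of s x] by auto
  qed
  have yv: "?ok (d y v)" and yw: "?ok (d y w)"
    using at_y[of v w] at_y[of w v] by auto
  \<comment> \<open>If \<open>x z\<close> had a third colour, \<open>z x y v\<close> or
    \<open>x z y v\<close> would be rainbow, according to which of the two colours
    \<open>y v\<close> has.\<close>
  have xz: "?ok (d x z)"
    using P[of z x y v] P[of x z y v] yv neq dist sym[of x z] sym[of y z] by auto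
  define C where "C = {d x y, d y z}"
  have in_C: "d x y \<in> C" "d y z \<in> C" "d z v \<in> C" "d z w \<in> C" "d x v \<in> C" "d x w \<in> C"
    "d v w \<in> C" "d y v \<in> C" "d y w \<in> C" "d x z \<in> C"
    using zv zw xv xw vw yv yw xz by (auto simp: C_def)
  moreover have "d q p \<in> C" if "d p q \<in> C" for p q
    using that sym[of p q] by simp
  note this[OF in_C(1)] this[OF in_C(2)] this[OF in_C(3)] this[OF in_C(4)] this[OF in_C(5)]
    this[OF in_C(6)] this[OF in_C(7)] this[OF in_C(8)] this[OF in_C(9)] this[OF in_C(10)]
  ultimately have "\<forall>p \<in> S. \<forall>q \<in> S. p \<noteq> q \<longrightarrow> d p q \<in> C"
    unfolding S_eq by simp
  then show "uses_two_colours d S"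
    unfolding uses_two_colours_def C_def by blast
qed

text \<open>Two differently coloured edges \<open>x y\<close>, \<open>y z\<close> and any edge that
  meets \<open>{x, y, z}\<close> lie in a common 4-set. For an edge \<open>u v\<close> disjoint from
  the triangle, \<open>y u\<close> differs in colour from \<open>x y\<close> or from
  \<open>y z\<close>, and the 4-set \<open>{x, y, u, v}\<close> or \<open>{y, z, u, v}\<close>
  decides.\<close>

lemma uses_two_colours_if_four_subsets:
  assumes sym: "\<And>x y. d x y = d y x"
    and X: "4 \<le> card X"
    and four: "\<And>S. \<lbrakk>S \<subseteq> X; card S = 4\<rbrakk> \<Longrightarrow> uses_two_colours d S"
  shows "uses_two_colours d X"
  using sym
proof (rule uses_two_coloursI_adjacent)
  fix x y z
  assume xyz: "x \<in> X" "y \<in> X" "z \<in> X" "distinct [x, y, z]" and neq: "d x y \<noteq> d y z"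
  let ?ok = "\<lambda>t. t = d x y \<or> t = d y z"
  have three: "\<not> distinct [d p p', d q q', d r r']"
    if "{a, b, e, f} \<subseteq> X" "distinct [a, b, e, f]" "{p, p', q, q', r, r'} \<subseteq> {a, b, e, f}"
      "p \<noteq> p'" "q \<noteq> q'" "r \<noteq> r'" for a b e f p p' q q' r r'
  proof -
    have "uses_two_colours d {a, b, e, f}"
      using that(1,2) by (intro four) auto
    then obtain i j where
      "\<forall>x \<in> {a, b, e, f}. \<forall>y \<in> {a, b, e, f}. x \<noteq> y \<longrightarrow> d x y = i \<or> d x y = j"
      unfolding uses_two_colours_def by blast
    then have "d p p' = i \<or> d p p' = j" "d q q' = i \<or> d q q' = j" "d r r' = i \<or> d r r' = j"
      using that(3-6) by blast+
    then show ?thesis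
      by auto
  qed
  have near: "?ok (d u v)" if "u \<in> {x, y, z}" "v \<in> X" "u \<noteq> v" for u v
  proof -
    have "\<exists>w \<in> X - {x, y, z}. v \<in> {x, y, z, w}"
    proof (cases "v \<in> {x, y, z}")
      case True
      have "\<not> X \<subseteq> {x, y, z}"
        using X xyz(4) card_mono[of "{x, y, z}" X] by auto
      then show ?thesis
        using True by blast
    qed (use that in auto)
    then obtain w where "w \<in> X - {x, y, z}" "v \<in> {x, y, z, w}"
      by blast
    then show ?thesis
      using three[of x y z w x y y z u v] xyz that neq by auto
  qed
  have "?ok (d u v)" if uv: "u \<in> X" "v \<in> X" "u \<noteq> v" for u v
  proof (cases "u \<in> {x, y, z} \<or> v \<in> {x, y, z}")
    case True
    then show ?thesis
      using near[of u v] near[of v u] uv sym[of u v] by auto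
  next
    case False
    have "?ok (d y u)"
      using near[of y u] False uv by auto
    then show ?thesis
      using three[of x y u v x y u v y u] three[of y z u v y z u v y u] False uv xyz neq by auto
  qed
  then show "uses_two_colours d X"
    unfolding uses_two_colours_def by blast
qed

section \<open>Colours of the triples through a vertex\<close>

lemma nsets_3_containing:
  assumes "e \<in> [V]\<^bsup>3\<^esup>" "v \<in> e"
  obtains x y where "e = {v, x, y}" "distinct [v, x, y]" "{v, x, y} \<subseteq> V"
proof -
  have "card (e - {v}) = 2" "e \<subseteq> V"
    using assms by (auto simp: nsets_def)
  then obtain x y where "e - {v} = {x, y}" "x \<noteq> y"
    by (meson card_2_iff)
  then have "e = {v, x, y}" "distinct [v, x, y]"
    using assms(2) by auto
  then show ?thesis
    using that \<open>e \<subseteq> V\<close> by blast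
qed

text \<open>Colour each pair of the 5-set \<open>insert v S\<close> by its complementary triple:
  this uses at most two colours, in particular on the triples through \<open>v\<close>. The bound on
  \<open>n\<close> leaves at least four vertices in the link, as the passage from 4-sets
  requires.\<close>

lemma link_uses_two_colours:
  fixes c :: "nat set \<Rightarrow> nat"
  assumes norb: "\<not> has_rainbow_copy c tight_path (complete_three_graph n)"
    and n: "5 \<le> n" and v: "v < n"
  shows "uses_two_colours (\<lambda>x y. c {v, x, y}) ({..<n} - {v})"
proof (rule uses_two_colours_if_four_subsets)
  show "c {v, x, y} = c {v, y, x}" for x y
    by (simp add: insert_commute)
  show "4 \<le> card ({..<n} - {v})"
    using n v by simp
next
  fix S
  assume S: "S \<subseteq> {..<n} - {v}" "card S = 4"
  define T where "T = insert v S"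
  have fin: "finite S"
    using S(2) card.infinite by fastforce
  have T: "card T = 5" "T \<subseteq> {..<n}" "finite T"
    using S fin v by (auto simp: T_def card_insert_if)
  have "uses_two_colours (\<lambda>x y. c (T - {x, y})) T"
  proof (rule five_vertices_without_rainbow_path)
    show "c (T - {x, y}) = c (T - {y, x})" for x y
      by (simp add: insert_commute)
    show "card T = 5"
      by (fact T)
  next
    fix p q r s
    assume pqrs: "{p, q, r, s} \<subseteq> T" "distinct [p, q, r, s]"
    have "card (T - {p, q, r, s}) = 1"
      using T pqrs by (simp add: card_Diff_subset)
    then obtain t where t: "T - {p, q, r, s} = {t}"
      by (meson card_1_singletonE)
    then have T_eq: "T = {p, q, r, s, t}" and dist: "distinct [s, t, p, q, r]"
      using pqrs by auto
    \<comment> \<open>the path \<open>p q r s\<close> consists of the complements of the tight path \<open>r s t p q\<close>\<close>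
    have "T - {p, q} = {r, s, t}" "T - {q, r} = {s, t, p}" "T - {r, s} = {t, p, q}"
      using dist unfolding T_eq by auto
    then show "c (T - {p, q}) = c (T - {q, r}) \<or> c (T - {q, r}) = c (T - {r, s}) \<or>
        c (T - {p, q}) = c (T - {r, s})"
      using tight_path_rainbow[of r s t p q n c] norb dist T(2) unfolding T_eq by auto
  qed
  then obtain i j where
    ij: "\<forall>x \<in> T. \<forall>y \<in> T. x \<noteq> y \<longrightarrow> c (T - {x, y}) = i \<or> c (T - {x, y}) = j"
    unfolding uses_two_colours_def by (elim exE)
  have "c {v, x, y} = i \<or> c {v, x, y} = j" if xy: "x \<in> S" "y \<in> S" "x \<noteq> y" for x y
  proof -
    have "card (S - {x, y}) = 2"
      using S(2) fin xy by (simp add: card_Diff_subset)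
    then obtain p q where pq: "S - {x, y} = {p, q}" "p \<noteq> q"
      by (meson card_2_iff)
    have "S = {x, y, p, q}" "p \<notin> {x, y}" "q \<notin> {x, y}"
      using pq xy by auto
    then have "{v, x, y} = T - {p, q}"
      using S(1) unfolding T_def by auto
    moreover have "p \<in> T" "q \<in> T"
      using pq unfolding T_def by auto
    ultimately show ?thesis
      using ij pq(2) by metis
  qed
  then show "uses_two_colours (\<lambda>x y. c {v, x, y}) S"
    unfolding uses_two_colours_def by (intro exI[of _ i] exI[of _ j]) simp
qed

lemma at_most_two_colours_at_vertex:
  fixes c :: "nat set \<Rightarrow> nat"
  assumes "\<not> has_rainbow_copy c tight_path (complete_three_graph n)" "5 \<le> n" "v < n"
  shows "\<exists>i j. \<forall>e \<in> [{..<n}]\<^bsup>3\<^esup>. v \<in> e \<longrightarrow> c e = i \<or> c e = j"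
proof -
  obtain i j where ij: "\<forall>x \<in> {..<n} - {v}. \<forall>y \<in> {..<n} - {v}. x \<noteq> y \<longrightarrow>
      c {v, x, y} = i \<or> c {v, x, y} = j"
    using link_uses_two_colours[OF assms] unfolding uses_two_colours_def by blast
  have "c e = i \<or> c e = j" if e: "e \<in> [{..<n}]\<^bsup>3\<^esup>" "v \<in> e" for e
  proof -
    obtain x y where "e = {v, x, y}" "distinct [v, x, y]" "{v, x, y} \<subseteq> {..<n}"
      using nsets_3_containing[OF e] .
    then show ?thesis
      using ij by auto
  qed
  then show ?thesis
    by blast
qed

section \<open>The dominating colour\<close>

text \<open>A colour that fails as \<open>z\<close> is missing at some vertex. If all colours fail,
  let \<open>a\<close> see only \<open>i\<close> and \<open>j\<close>, let \<open>p\<close> miss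
  \<open>i\<close> and let \<open>q\<close> miss \<open>j\<close>: a triple containing all three has
  no possible colour.\<close>

lemma dominating_colour:
  fixes c :: "'a set \<Rightarrow> 'c"
  assumes V: "3 \<le> card V"
    and two: "\<And>v. v \<in> V \<Longrightarrow> \<exists>i j. \<forall>e \<in> [V]\<^bsup>3\<^esup>. v \<in> e \<longrightarrow> c e = i \<or> c e = j"
  obtains z where "\<And>v. v \<in> V \<Longrightarrow> \<exists>i. \<forall>e \<in> [V]\<^bsup>3\<^esup>. v \<in> e \<longrightarrow> c e = z \<or> c e = i"
proof -
  define good where "good = (\<lambda>z. \<forall>v \<in> V. \<exists>i. \<forall>e \<in> [V]\<^bsup>3\<^esup>. v \<in> e \<longrightarrow> c e = z \<or> c e = i)"
  have avoid: "\<exists>v \<in> V. \<forall>e \<in> [V]\<^bsup>3\<^esup>. v \<in> e \<longrightarrow> c e \<noteq> z" if bad: "\<not> good z" for z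
  proof -
    obtain v where v: "v \<in> V" "\<nexists>i. \<forall>e \<in> [V]\<^bsup>3\<^esup>. v \<in> e \<longrightarrow> c e = z \<or> c e = i"
      using bad unfolding good_def by blast
    obtain i j where ij: "\<forall>e \<in> [V]\<^bsup>3\<^esup>. v \<in> e \<longrightarrow> c e = i \<or> c e = j"
      using two[OF v(1)] by blast
    have "z \<noteq> i" "z \<noteq> j"
      using v(2) ij by blast+
    then show ?thesis
      using v(1) ij by metis
  qed
  have "\<exists>z. good z"
  proof (rule ccontr)
    assume none: "\<nexists>z. good z"
    obtain a where a: "a \<in> V"
      using V by fastforce
    obtain i j where ij: "\<forall>e \<in> [V]\<^bsup>3\<^esup>. a \<in> e \<longrightarrow> c e = i \<or> c e = j"
      using two[OF a] by blast
    obtain p where p: "p \<in> V" "\<forall>e \<in> [V]\<^bsup>3\<^esup>. p \<in> e \<longrightarrow> c e \<noteq> i"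
      using avoid none by blast
    obtain q where q: "q \<in> V" "\<forall>e \<in> [V]\<^bsup>3\<^esup>. q \<in> e \<longrightarrow> c e \<noteq> j"
      using avoid none by blast
    have "finite V"
      using V card.infinite by fastforce
    \<comment> \<open>The vertices \<open>a\<close>, \<open>p\<close>, \<open>q\<close> may
      coincide, so they are enlarged to a triple, which \<open>3 \<le> card V\<close>
      permits.\<close>
    moreover have "card {a, p, q} \<le> 3"
      by (simp add: card_insert_if)
    ultimately obtain e where "{a, p, q} \<subseteq> e" "e \<subseteq> V" "card e = 3"
      using exists_subset_between[of "{a, p, q}" 3 V] V a p(1) q(1) by auto
    moreover from this have "e \<in> [V]\<^bsup>3\<^esup>"
      using \<open>finite V\<close> finite_subset by (auto simp: nsets_def)
    ultimately show False
      using bspec[OF ij, of e] bspec[OF p(2), of e] bspec[OF q(2), of e] by auto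
  qed
  then obtain z where "good z" ..
  then show ?thesis
    using that[of z] unfolding good_def by simp
qed

section \<open>Merging colours in a connected hypergraph\<close>

text \<open>A walk from a vertex of \<open>e\<close> to a vertex of \<open>f\<close> carries the
  colour along, since consecutive edges share a vertex.\<close>

lemma connected_edges_same_colour:
  assumes H: "three_graph H" "connected_hypergraph H"
    and local: "\<And>e f v. \<lbrakk>e \<in> hedges H; f \<in> hedges H; v \<in> e; v \<in> f\<rbrakk> \<Longrightarrow> g e = g f"
    and ef: "e \<in> hedges H" "f \<in> hedges H"
  shows "g e = g f"
proof -
  let ?R = "{(x, y). \<exists>e \<in> hedges H. x \<in> e \<and> y \<in> e}"
  have "e \<in> [verts H]\<^bsup>3\<^esup>" "f \<in> [verts H]\<^bsup>3\<^esup>"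
    using H(1) ef unfolding three_graph_def by auto
  then have "e \<subseteq> verts H" "f \<subseteq> verts H" "e \<noteq> {}" "f \<noteq> {}"
    by (auto simp: nsets_def)
  then obtain u v where uv: "u \<in> e" "v \<in> f" "u \<in> verts H" "v \<in> verts H"
    by blast
  then have "(u, v) \<in> ?R\<^sup>*"
    using H(2) unfolding connected_hypergraph_def by blast
  \<comment> \<open>The invariant concerns all edges at the current vertex: the edge leading to the
    next vertex then has colour \<open>g e\<close>, and so have all edges there.\<close>
  then have "\<forall>f \<in> hedges H. v \<in> f \<longrightarrow> g f = g e"
  proof (induction rule: rtrancl_induct)
    case base
    then show ?case
      using local ef(1) uv(1) by metis
  next
    case (step y z)
    then obtain e' where "e' \<in> hedges H" "y \<in> e'" "z \<in> e'"
      by blast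
    then show ?case
      using step.IH local by metis
  qed
  then show ?thesis
    using ef(2) uv(2) by metis
qed

lemma two_colours_no_rainbow_tight_path:
  fixes c :: "nat set \<Rightarrow> nat"
  assumes c: "c \<in> hedges K \<rightarrow> {..<2}"
  shows "\<not> has_rainbow_copy c tight_path K"
proof
  assume "has_rainbow_copy c tight_path K"
  then obtain \<phi> where \<phi>: "hembedding \<phi> tight_path K"
    and inj: "inj_on (\<lambda>e. c (\<phi> ` e)) (hedges tight_path)"
    unfolding has_rainbow_copy_def by blast
  have "(\<lambda>e. c (\<phi> ` e)) ` hedges tight_path \<subseteq> {..<2}"
    using \<phi> c unfolding hembedding_def by blast
  then have "card (hedges tight_path) \<le> 2"
    using card_inj_on_le[OF inj, of "{..<2}"] by simp
  moreover have "{1, 2, 3 :: nat} \<noteq> {2, 3, 4}" "{1, 2, 3 :: nat} \<noteq> {3, 4, 5}"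
    "{2, 3, 4 :: nat} \<noteq> {3, 4, 5}"
    by (simp_all add: set_eq_subset)
  ultimately show False
    by (simp add: tight_path_def)
qed

text \<open>The assumption \<open>two\<close> ranges over all colourings because it is applied to
  the one that merges all colours except \<open>z\<close>.\<close>

lemma mono_copy_if_no_rainbow_tight_path:
  fixes c :: "nat set \<Rightarrow> nat"
  assumes H: "three_graph H" "connected_hypergraph H"
    and n: "5 \<le> n"
    and two: "\<And>c :: nat set \<Rightarrow> nat. c \<in> hedges (complete_three_graph n) \<rightarrow> {..<2} \<Longrightarrow>
      has_mono_copy c H (complete_three_graph n)"
    and norb: "\<not> has_rainbow_copy c tight_path (complete_three_graph n)"
  shows "has_mono_copy c H (complete_three_graph n)"
proof -
  obtain z where z: "\<And>v. v \<in> {..<n} \<Longrightarrow>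
      \<exists>i. \<forall>e \<in> [{..<n}]\<^bsup>3\<^esup>. v \<in> e \<longrightarrow> c e = z \<or> c e = i"
    using dominating_colour[of "{..<n}" c] at_most_two_colours_at_vertex[OF norb n] n by auto
  have "has_mono_copy (\<lambda>e. if c e = z then 0 else 1 :: nat) H (complete_three_graph n)"
    by (rule two) auto
  then obtain \<phi> k where \<phi>: "hembedding \<phi> H (complete_three_graph n)"
    and k: "\<forall>e \<in> hedges H. (if c (\<phi> ` e) = z then 0 else 1 :: nat) = k"
    unfolding has_mono_copy_def by blast
  have img: "\<phi> ` e \<in> [{..<n}]\<^bsup>3\<^esup>" if "e \<in> hedges H" for e
    using \<phi> that unfolding hembedding_def complete_three_graph_def by simp
  have same: "c (\<phi> ` e) = c (\<phi> ` f)" if ef: "e \<in> hedges H" "f \<in> hedges H" for e f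
  proof (cases "k = 0")
    case True
    then show ?thesis
      using k ef by (metis zero_neq_one)
  next
    case False
    then have not_z: "c (\<phi> ` e) \<noteq> z" if "e \<in> hedges H" for e
      using k that by metis
    show ?thesis
      using H
    proof (rule connected_edges_same_colour[where g = "\<lambda>e. c (\<phi> ` e)"])
      fix e f v
      assume ef: "e \<in> hedges H" "f \<in> hedges H" "v \<in> e" "v \<in> f"
      have "\<phi> v \<in> {..<n}"
        using img[OF ef(1)] ef(3) unfolding nsets_def by blast
      \<comment> \<open>The images of edges through \<open>v\<close> meet in
        \<open>\<phi> v\<close>, where only one colour other than \<open>z\<close> can
        occur.\<close>
      from z[OF this] show "c (\<phi> ` e) = c (\<phi> ` f)"
        using img ef not_z by (metis imageI)
    qed (use ef in auto)
  qed
  then show ?thesis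
    using \<phi> unfolding has_mono_copy_def by metis
qed

section \<open>At most four vertices\<close>

text \<open>Splitting the four triples of a 4-set into two pairs leaves room for at most two edges.
  Two distinct edges span at least four vertices, hence exactly four here, which is the excluded
  case.\<close>

lemma card_edges_le_1_if_two_colour_ramsey_le_4:
  assumes H: "three_graph H" "\<not> (card (verts H) = 4 \<and> card (hedges H) = 2)"
    and n: "n \<le> 4"
    and two: "\<And>c :: nat set \<Rightarrow> nat. c \<in> hedges (complete_three_graph n) \<rightarrow> {..<2} \<Longrightarrow>
      has_mono_copy c H (complete_three_graph n)"
  shows "card (hedges H) \<le> 1"
proof (rule ccontr)
  assume many: "\<not> card (hedges H) \<le> 1"
  \<comment> \<open>The triples in \<open>{..<4}\<close> containing \<open>{0, 1}\<close> are
    \<open>{0, 1, 2}\<close> and \<open>{0, 1, 3}\<close>, so each colour class has two elements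
    there.\<close>
  define c where "c = (\<lambda>e :: nat set. if {0, 1} \<subseteq> e then 0 else 1 :: nat)"
  have "has_mono_copy c H (complete_three_graph n)"
    by (rule two) (auto simp: c_def)
  then obtain \<phi> k where \<phi>: "hembedding \<phi> H (complete_three_graph n)"
    and k: "\<forall>e \<in> hedges H. c (\<phi> ` e) = k"
    unfolding has_mono_copy_def by blast
  have card_edge: "card e = 3" "finite e" if "e \<in> hedges H" for e
    using H(1) that unfolding three_graph_def nsets_def by blast+
  have "hedges H \<subseteq> Pow (verts H)"
    using H(1) unfolding three_graph_def nsets_def by blast
  moreover have "inj_on ((`) \<phi>) (Pow (verts H))"
    using \<phi> unfolding hembedding_def by (intro inj_on_image_Pow) simp
  ultimately have inj: "inj_on ((`) \<phi>) (hedges H)"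
    by (rule inj_on_subset[rotated])
  have "(`) \<phi> ` hedges H \<subseteq> {e \<in> [{..<4}]\<^bsup>3\<^esup>. c e = k}"
  proof (intro image_subsetI CollectI conjI)
    fix e
    assume e: "e \<in> hedges H"
    have "\<phi> ` e \<in> [{..<n}]\<^bsup>3\<^esup>"
      using \<phi> e by (simp add: hembedding_def complete_three_graph_def)
    then show "\<phi> ` e \<in> [{..<4}]\<^bsup>3\<^esup>"
      using n by (auto simp: nsets_def)
    show "c (\<phi> ` e) = k"
      using k e by simp
  qed
  also have "\<dots> \<subseteq> (if k = 0 then {{0, 1, 2}, {0, 1, 3}} else {{0, 2, 3}, {1, 2, 3}})"
  proof
    fix e
    assume e: "e \<in> {e \<in> [{..<4}]\<^bsup>3\<^esup>. c e = k}"
    then have "card ({..<4} - e) = 1"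
      by (auto simp: nsets_def card_Diff_subset)
    then obtain x where x: "{..<4} - e = {x}"
      by (meson card_1_singletonE)
    moreover have "e \<subseteq> {..<4}"
      using e by (simp add: nsets_def)
    moreover have "{..<4} = {0, 1, 2, 3 :: nat}"
      by auto
    ultimately have e_eq: "e = {0, 1, 2, 3} - {x}" and "x \<in> {0, 1, 2, 3}"
      by blast+
    then consider "x = 0" | "x = 1" | "x = 2" | "x = 3"
      by blast
    then have "e \<in> {{1, 2, 3}, {0, 2, 3}, {0, 1, 3}, {0, 1, 2}}"
      by cases (simp_all add: e_eq insert_Diff_if)
    then consider "e = {1, 2, 3}" | "e = {0, 2, 3}" | "e = {0, 1, 3}" | "e = {0, 1, 2}"
      by blast
    then show "e \<in> (if k = 0 then {{0, 1, 2}, {0, 1, 3}} else {{0, 2, 3}, {1, 2, 3}})"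
      using e by cases (simp_all add: c_def split: if_splits)
  qed
  finally have "card (hedges H) \<le> card (if k = 0 then {{0, 1, 2}, {0, 1, 3}}
      else {{0, 2, 3}, {1, 2, 3 :: nat}})"
    by (intro card_inj_on_le[OF inj]) auto
  also have "\<dots> \<le> 2"
    by (simp add: card_insert_if)
  finally have card2: "card (hedges H) = 2"
    using many by simp
  then obtain e f where ef: "hedges H = {e, f}" "e \<noteq> f"
    by (meson card_2_iff)
  \<comment> \<open>Distinct 3-sets are incomparable, so their union has at least four
    elements.\<close>
  then have "\<not> f \<subseteq> e"
    using card_edge[of e] card_edge[of f] card_subset_eq[of e f] by auto
  then have "card e < card (e \<union> f)"
    using card_edge[of e] card_edge[of f] ef by (intro psubset_card_mono) auto
  moreover have "card (e \<union> f) \<le> card (verts H)"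
    using H(1) ef unfolding three_graph_def nsets_def by (intro card_mono) auto
  ultimately have "card (verts H) = 4"
    using hembedding_card[OF \<phi>] n card_edge[of e] ef by simp
  then show False
    using H(2) card2 by blast
qed

lemma mono_copy_if_card_edges_le_1:
  assumes "finite (hedges H)" "card (hedges H) \<le> 1" "hembedding \<phi> H K"
  shows "has_mono_copy c H K"
proof -
  have "e = f" if "e \<in> hedges H" "f \<in> hedges H" for e f
    using that assms(1,2) card_le_Suc0_iff_eq[of "hedges H"] by auto
  then show ?thesis
    using assms(3) unfolding has_mono_copy_def by metis
qed

theorem theorem1p8:
  fixes H :: "'a hypergraph"
  assumes "three_graph H"
    and "connected_hypergraph H"
    and "\<not> (card (verts H) = 4 \<and> card (hedges H) = 2)"
  shows "constrained_ramsey H tight_path = ramsey_two H"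
proof -
  \<comment> \<open>The equivalence is shown for each \<open>n\<close> separately, so both
    \<open>LEAST\<close> terms have the same predicate.\<close>
  have "(\<forall>c :: nat set \<Rightarrow> nat. has_mono_copy c H (complete_three_graph n) \<or>
        has_rainbow_copy c tight_path (complete_three_graph n)) \<longleftrightarrow>
      (\<forall>c :: nat set \<Rightarrow> nat. c \<in> hedges (complete_three_graph n) \<rightarrow> {..<2} \<longrightarrow>
        has_mono_copy c H (complete_three_graph n))" (is "?constrained \<longleftrightarrow> ?two") for n
  proof
    assume ?constrained
    then show ?two
      using two_colours_no_rainbow_tight_path by blast
  next
    assume two: ?two
    show ?constrained
    proof (cases "5 \<le> n")
      case True
      then show ?thesis
        using mono_copy_if_no_rainbow_tight_path[OF assms(1,2)] two by blast
    next
      case False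
      then have "n \<le> 4"
        by simp
      then have "card (hedges H) \<le> 1"
        using card_edges_le_1_if_two_colour_ramsey_le_4[OF assms(1,3)] two by blast
      moreover have "finite (hedges H)"
        using assms(1) finite_imp_finite_nsets finite_subset unfolding three_graph_def by blast
      \<comment> \<open>The constant colouring serves to obtain an embedding of
        \<open>H\<close>.\<close>
      moreover have "has_mono_copy (\<lambda>_. 0 :: nat) H (complete_three_graph n)"
        using two by auto
      then obtain \<phi> where "hembedding \<phi> H (complete_three_graph n)"
        unfolding has_mono_copy_def by blast
      ultimately show ?thesis
        using mono_copy_if_card_edges_le_1 by blast
    qed
  qed
  then show ?thesis
    unfolding constrained_ramsey_def ramsey_two_def by simp
qed

end
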